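(* For every integer $k\ge 1$, $$\sum_{n\ge 0}a(n,2k,t)\,x^n=\frac{(1+x)\Phi_k(x,t)-x^2\bigl(1+(1-t)x\bigr)\Phi_{k-1}(x,t)}{\Lambda_k(x,t)-x^2\Lambda_{k-1}(x,t)}$$ as formal power series in $x$ (with coefficients polynomials in $t$).
   Context: Up-step $U:(i,j)\to(i+1,j+1)$, down-step $D:(i,j)\to(i+1,j-1)$. For integers $n,k\ge 0$, $A_{n,k}$ is the set of lattice paths of length $n$ consisting of $U$ and $D$ steps that start at $(0,0)$, end at height $0$ or $-1$, and stay in the strip $-\lfloor (k+1)/2\rfloor\le y\le \lfloor k/2\rfloor$. A peak of a path is a vertex preceded by a $U$ and followed by a $D$; a valley is a vertex preceded by a $D$ and followed by a $U$; the height of a vertex is its $y$-coordinate. The extremal points of a path $v$ are its peaks of height $\ge 1$ and its valleys of height $\le -2$; $e(v)$ is their number. Define $a(n,k,t)=\sum_{v\in A_{n,k}}t^{e(v)}$. Fibonacci polynomials: $F_0(x,s)=0$, $F_1(x,s)=1$, $F_n=xF_{n-1}+sF_{n-2}$. Lucas polynomials: $L_0(x,s)=2$, $L_1(x,s)=x$, $L_n=xL_{n-1}+sL_{n-2}$. Set $\Phi_n(x,t)=F_n(1+(1-t)x^2,-x^2)$ and $\Lambda_n(x,t)=L_n(1+(1-t)x^2,-x^2)$. *)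

theory Defs
  imports "HOL-Computational_Algebra.Computational_Algebra"
begin

datatype step = Up | Down

fun step_height :: "step \<Rightarrow> int" where
  "step_height Up = 1"
| "step_height Down = -1"

text \<open>A path starting at the origin is the list of its steps. Its vertices are indexed by
  \<open>i = 0, \<dots>, length v\<close>; vertex \<open>i\<close> is the point \<open>(i, height v i)\<close>, it is preceded by the step
  \<open>v ! (i - 1)\<close> and followed by the step \<open>v ! i\<close>.\<close>

definition height :: "step list \<Rightarrow> nat \<Rightarrow> int" where
  "height v i = (\<Sum>s\<leftarrow>take i v. step_height s)"

definition paths :: "nat \<Rightarrow> nat \<Rightarrow> step list set" where
  "paths n k = {v. length v = n \<and> height v n \<in> {0, -1} \<and>
     (\<forall>i\<le>n. - int ((k + 1) div 2) \<le> height v i \<and> height v i \<le> int (k div 2))}"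

definition is_peak :: "step list \<Rightarrow> nat \<Rightarrow> bool" where
  "is_peak v i \<longleftrightarrow> 0 < i \<and> i < length v \<and> v ! (i - 1) = Up \<and> v ! i = Down"

definition is_valley :: "step list \<Rightarrow> nat \<Rightarrow> bool" where
  "is_valley v i \<longleftrightarrow> 0 < i \<and> i < length v \<and> v ! (i - 1) = Down \<and> v ! i = Up"

definition extremal_points :: "step list \<Rightarrow> nat set" where
  "extremal_points v =
     {i. is_peak v i \<and> height v i \<ge> 1} \<union> {i. is_valley v i \<and> height v i \<le> -2}"

definition num_extremal :: "step list \<Rightarrow> nat" where
  "num_extremal v = card (extremal_points v)"

definition path_poly :: "nat \<Rightarrow> nat \<Rightarrow> 'a::comm_ring_1 \<Rightarrow> 'a" where
  "path_poly n k t = (\<Sum>v\<in>paths n k. t ^ num_extremal v)"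

text \<open>The sets below are finite, so neither the cardinality nor the sum takes its default value.\<close>

lemma finite_extremal_points: "finite (extremal_points v)"
  by (rule finite_subset[of _ "{..<length v}"])
     (auto simp: extremal_points_def is_peak_def is_valley_def)

lemma finite_paths: "finite (paths n k)"
proof -
  have "(UNIV :: step set) = {Up, Down}"
    using step.exhaust by auto
  then have "finite (UNIV :: step set)"
    by (metis finite.emptyI finite.insertI)
  then have "finite {v :: step list. set v \<subseteq> UNIV \<and> length v = n}"
    by (rule finite_lists_length_eq)
  then show ?thesis
    by (rule rev_finite_subset) (auto simp: paths_def)
qed

fun fibonacci_poly :: "nat \<Rightarrow> 'a::comm_ring_1 \<Rightarrow> 'a \<Rightarrow> 'a" where
  "fibonacci_poly 0 x s = 0"
| "fibonacci_poly (Suc 0) x s = 1"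
| "fibonacci_poly (Suc (Suc n)) x s = x * fibonacci_poly (Suc n) x s + s * fibonacci_poly n x s"

fun lucas_poly :: "nat \<Rightarrow> 'a::comm_ring_1 \<Rightarrow> 'a \<Rightarrow> 'a" where
  "lucas_poly 0 x s = 2"
| "lucas_poly (Suc 0) x s = x"
| "lucas_poly (Suc (Suc n)) x s = x * lucas_poly (Suc n) x s + s * lucas_poly n x s"

definition Phi :: "nat \<Rightarrow> 'a::comm_ring_1 \<Rightarrow> 'a \<Rightarrow> 'a" where
  "Phi n x t = fibonacci_poly n (1 + (1 - t) * x\<^sup>2) (- x\<^sup>2)"

definition Lambda :: "nat \<Rightarrow> 'a::comm_ring_1 \<Rightarrow> 'a \<Rightarrow> 'a" where
  "Lambda n x t = lucas_poly n (1 + (1 - t) * x\<^sup>2) (- x\<^sup>2)"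

text \<open>Division of power series in the library needs coefficients with a multiplicative inverse,
  which integer polynomials do not have. For a denominator with constant term \<open>1\<close> the quotient
  exists over every commutative ring; it is characterised by \<open>fps_quot_eq_iff\<close>. Denominators with
  any other constant term do not occur, by \<open>fps_nth_0_denominator\<close>.\<close>

definition fps_quot :: "'a::comm_ring_1 fps \<Rightarrow> 'a fps \<Rightarrow> 'a fps" where
  "fps_quot f g = f * fps_right_inverse g 1"

lemma fps_quot_eq_iff:
  assumes "fps_nth g 0 = 1"
  shows "h = fps_quot f g \<longleftrightarrow> h * g = f"
proof -
  have inv: "g * fps_right_inverse g 1 = 1"
    by (rule fps_right_inverse) (simp add: assms)
  show ?thesis
  proof
    assume "h = fps_quot f g"
    then have "h * g = f * (g * fps_right_inverse g 1)"
      by (simp only: fps_quot_def ac_simps)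
    then show "h * g = f"
      by (simp only: inv mult_1_right)
  next
    assume "h * g = f"
    then have "fps_quot f g = h * (g * fps_right_inverse g 1)"
      by (simp only: fps_quot_def mult.assoc[symmetric])
    then show "h = fps_quot f g"
      by (simp only: inv mult_1_right)
  qed
qed

lemma fps_nth_0_denominator:
  fixes t :: "'a::comm_ring_1 fps"
  assumes "k \<ge> 1"
  shows "fps_nth (Lambda k fps_X t - fps_X\<^sup>2 * Lambda (k - 1) fps_X t) 0 = 1"
proof -
  have "fps_nth (lucas_poly (Suc n) (1 + (1 - t) * fps_X\<^sup>2) (- fps_X\<^sup>2)) 0 = 1" for n
    by (induction n) (auto simp: power2_eq_square)
  from this[of "k - 1"] assms show ?thesis
    by (simp add: Lambda_def power2_eq_square)
qed

end

(* Cutting the strip -k..k between the heights -1 and 0 yields two ladders, with K = k and K = k - 1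
   levels beyond their first one; reflecting the lower ladder turns its valleys into peaks. Reading a
   path step by step gives a linear system for the generating functions of the remainders of paths,
   indexed by the current height and the previous step. Eliminating each ladder from its far end gives
   the continuant Q_m = Phi_(m+1) - (1 - t) x^2 Phi_m, so that the unknowns a, b at the heights 0, -1
   satisfy Q_(k+1) a = Q_k (1 + x b) and Q_k b = Q_(k-1) (1 + x a). Eliminating b gives
   (Q_(k+1) - x^2 Q_(k-1)) a = Q_k + x Q_(k-1), which is the claim rewritten. *)

theory Submission
  imports Defs
begin

text \<open>Extremality of a vertex depends only on its height and its two adjacent steps, so the
  last step and the current height suffice as state when a path is read step by step.\<close>

definition is_turn :: "step \<Rightarrow> step \<Rightarrow> int \<Rightarrow> bool" where
  "is_turn p s h \<longleftrightarrow> p = Up \<and> s = Down \<and> h \<ge> 1 \<or> p = Down \<and> s = Up \<and> h \<le> -2"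

fun turns :: "step \<Rightarrow> int \<Rightarrow> step list \<Rightarrow> nat" where
  "turns p h [] = 0"
| "turns p h (s # v) = of_bool (is_turn p s h) + turns s (h + step_height s) v"

lemma height_0 [simp]: "height v 0 = 0"
  by (simp add: height_def)

lemma height_Cons_Suc [simp]: "height (s # v) (Suc i) = step_height s + height v i"
  by (simp add: height_def)

lemma Collect_eq_Suc_image:
  "{i. P i} = (if P 0 then {0} else {}) \<union> Suc ` {i. P (Suc i)}"
  by (auto simp: image_iff) (metis not0_implies_Suc)+

text \<open>Prepending \<open>p\<close> makes \<open>(p # v) ! i\<close> the step before vertex
  \<open>i\<close>. The induction splits off vertex 0 and shifts the other indices by
  \<open>Suc\<close>.\<close>

lemma card_turns:
  "card {i. i < length v \<and> is_turn ((p # v) ! i) (v ! i) (h + height v i)} = turns p h v"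
proof (induction v arbitrary: p h)
  case Nil
  then show ?case by simp
next
  case (Cons s v)
  let ?E = "{i. i < length v \<and> is_turn ((s # v) ! i) (v ! i) (h + step_height s + height v i)}"
  have "{i. i < length (s # v) \<and> is_turn ((p # s # v) ! i) ((s # v) ! i) (h + height (s # v) i)} =
      (if is_turn p s h then {0} else {}) \<union> Suc ` ?E"
    by (subst Collect_eq_Suc_image) (simp add: add.assoc)
  moreover have "card (Suc ` ?E) = turns s (h + step_height s) v"
    using Cons.IH[of s "h + step_height s"] by (simp add: card_image)
  moreover have "finite ?E"
    by simp
  ultimately show ?case
    by (simp add: card_insert_if image_iff)
qed

text \<open>The fictitious first step \<open>Up\<close> is harmless: no vertex of height \<open>0\<close> is extremal.\<close>

lemma num_extremal_eq_turns: "num_extremal v = turns Up 0 v"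
proof -
  have "extremal_points v = {i. i < length v \<and> is_turn ((Up # v) ! i) (v ! i) (0 + height v i)}"
    by (auto simp: extremal_points_def is_peak_def is_valley_def is_turn_def nth_Cons'
        split: if_splits)
  then show ?thesis
    unfolding num_extremal_def by (simp only: card_turns)
qed

definition tails :: "int \<Rightarrow> int \<Rightarrow> nat \<Rightarrow> int \<Rightarrow> step list set" where
  "tails a b n h = {v. length v = n \<and> h + height v n \<in> {0, -1} \<and>
     (\<forall>i\<le>n. a \<le> h + height v i \<and> h + height v i \<le> b)}"

lemma tails_outside: "h \<notin> {a..b} \<Longrightarrow> tails a b n h = {}"
  by (force simp: tails_def)

lemma tails_0: "tails a b 0 h = (if h \<in> {a..b} \<inter> {0, -1} then {[]} else {})"
  by (auto simp: tails_def)

lemma all_le_Suc: "(\<forall>i\<le>Suc n. P i) \<longleftrightarrow> P 0 \<and> (\<forall>i\<le>n. P (Suc i))"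
  by (metis Suc_le_mono le0 not0_implies_Suc)

lemma tails_Suc:
  assumes "h \<in> {a..b}"
  shows "tails a b (Suc n) h = (#) Up ` tails a b n (h + 1) \<union> (#) Down ` tails a b n (h - 1)"
proof (intro set_eqI)
  fix v
  show "v \<in> tails a b (Suc n) h \<longleftrightarrow>
    v \<in> (#) Up ` tails a b n (h + 1) \<union> (#) Down ` tails a b n (h - 1)"
  proof (cases v)
    case Nil
    then show ?thesis by (auto simp: tails_def)
  next
    case (Cons s w)
    then show ?thesis
      using assms by (cases s) (auto simp: tails_def all_le_Suc algebra_simps)
  qed
qed

lemma finite_tails: "finite (tails a b n h)"
proof (induction n arbitrary: h)
  case 0
  then show ?case by (simp add: tails_0)
next
  case (Suc n)
  then show ?case
    by (cases "h \<in> {a..b}") (simp_all add: tails_Suc tails_outside del: atLeastAtMost_iff)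
qed

definition tail_gf :: "int \<Rightarrow> int \<Rightarrow> 'a::comm_ring_1 \<Rightarrow> step \<Rightarrow> int \<Rightarrow> 'a fps" where
  "tail_gf a b c p h = Abs_fps (\<lambda>n. \<Sum>v\<in>tails a b n h. c ^ turns p h v)"

lemma tail_gf_outside: "h \<notin> {a..b} \<Longrightarrow> tail_gf a b c p h = 0"
  by (simp add: tail_gf_def tails_outside fps_eq_iff del: atLeastAtMost_iff)

text \<open>Split off the first step; the constant term counts the empty remainder, present exactly
  at an allowed final height.\<close>

lemma tail_gf_rec:
  assumes "h \<in> {a..b}"
  shows "tail_gf a b c p h = of_bool (h \<in> {0, -1}) +
    fps_X * (fps_const c ^ of_bool (is_turn p Up h) * tail_gf a b c Up (h + 1) +
             fps_const c ^ of_bool (is_turn p Down h) * tail_gf a b c Down (h - 1))"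
proof (rule fps_ext)
  fix n
  show "fps_nth (tail_gf a b c p h) n = fps_nth (of_bool (h \<in> {0, -1}) +
    fps_X * (fps_const c ^ of_bool (is_turn p Up h) * tail_gf a b c Up (h + 1) +
             fps_const c ^ of_bool (is_turn p Down h) * tail_gf a b c Down (h - 1))) n"
  proof (cases n)
    case 0
    then show ?thesis
      using assms by (auto simp: tail_gf_def tails_0)
  next
    case (Suc m)
    have "(\<Sum>v\<in>tails a b n h. c ^ turns p h v) =
        (\<Sum>v\<in>(#) Up ` tails a b m (h + 1). c ^ turns p h v) +
        (\<Sum>v\<in>(#) Down ` tails a b m (h - 1). c ^ turns p h v)"
      unfolding Suc tails_Suc[OF assms]
      by (rule sum.union_disjoint) (auto simp: finite_tails)
    also have "\<dots> = c ^ of_bool (is_turn p Up h) * (\<Sum>v\<in>tails a b m (h + 1). c ^ turns Up (h + 1) v) +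
        c ^ of_bool (is_turn p Down h) * (\<Sum>v\<in>tails a b m (h - 1). c ^ turns Down (h - 1) v)"
      by (simp add: sum.reindex power_add sum_distrib_left)
    finally show ?thesis
      by (simp add: tail_gf_def Suc fps_const_power)
  qed
qed

lemma path_poly_gf:
  "Abs_fps (\<lambda>n. path_poly n (2 * k) c) = tail_gf (- int k) (int k) c Up 0"
  by (simp add: path_poly_def tail_gf_def paths_def tails_def num_extremal_eq_turns)

text \<open>For m >= 1 this is the determinant of the m by m tridiagonal matrix with diagonal 1, A,
  ..., A, where A = 1 + (1 - t) x^2, and entries -x beside it. The entry 1 belongs to the far end of
  a ladder.\<close>

definition continuant :: "nat \<Rightarrow> 'a::comm_ring_1 \<Rightarrow> 'a \<Rightarrow> 'a" where
  "continuant m x t = Phi (Suc m) x t - (1 - t) * x\<^sup>2 * Phi m x t"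

lemma Phi_Suc_Suc: "Phi (Suc (Suc n)) x t = (1 + (1 - t) * x\<^sup>2) * Phi (Suc n) x t - x\<^sup>2 * Phi n x t"
  by (simp add: Phi_def)

lemma Lambda_Suc_Suc:
  "Lambda (Suc (Suc n)) x t = (1 + (1 - t) * x\<^sup>2) * Lambda (Suc n) x t - x\<^sup>2 * Lambda n x t"
  by (simp add: Lambda_def)

lemma continuant_0 [simp]: "continuant 0 x t = 1"
  and continuant_1 [simp]: "continuant (Suc 0) x t = 1"
  by (simp_all add: continuant_def Phi_def)

lemma continuant_Suc_Suc:
  "continuant (Suc (Suc m)) x t =
    (1 + (1 - t) * x\<^sup>2) * continuant (Suc m) x t - x\<^sup>2 * continuant m x t"
  by (simp add: continuant_def Phi_Suc_Suc algebra_simps)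

text \<open>Multiplying the first equation by \<open>continuant (Suc m) x t\<close> lets the second
  one eliminate \<open>b\<close> without any division.\<close>

lemma continuant_step:
  fixes a b c :: "'a::comm_ring_1"
  assumes "(1 + (1 - t) * x\<^sup>2) * a = x * b + c"
    and "continuant (Suc m) x t * b = x * continuant m x t * a"
  shows "continuant (Suc (Suc m)) x t * a = continuant (Suc m) x t * c"
proof -
  have "continuant (Suc (Suc m)) x t * a =
      continuant (Suc m) x t * ((1 + (1 - t) * x\<^sup>2) * a) - x * (x * continuant m x t * a)"
    by (simp add: continuant_Suc_Suc algebra_simps power2_eq_square)
  also have "\<dots> = continuant (Suc m) x t * (x * b + c) - x * (continuant (Suc m) x t * b)"
    by (simp only: assms)
  finally show ?thesis
    by (simp add: algebra_simps)
qed

text \<open>Here \<open>f h\<close> and \<open>g h\<close> belong to level \<open>h\<close> entered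
  outwards and inwards; only turning back after an outward step costs a factor \<open>t\<close>.
  Subtracting the two equations expresses \<open>f\<close> by \<open>g\<close>, which leaves a
  three-term recurrence for \<open>g\<close>.\<close>

lemma ladder_elimination:
  fixes f g :: "nat \<Rightarrow> 'a::comm_ring_1"
  assumes top: "f (Suc K) = 0"
    and bottom: "g 0 = c + x * f 1"
    and f: "\<And>h. 1 \<le> h \<Longrightarrow> h \<le> K \<Longrightarrow> f h = x * (f (h + 1) + t * g (h - 1))"
    and g: "\<And>h. 1 \<le> h \<Longrightarrow> h \<le> K \<Longrightarrow> g h = x * (f (h + 1) + g (h - 1))"
  shows "continuant (Suc K) x t * g 0 = continuant K x t * c"
proof (cases K)
  case 0
  then show ?thesis using top bottom by simp
next
  case (Suc M)
  have diff: "f h = g h - (1 - t) * x * g (h - 1)" if "1 \<le> h" "h \<le> K" for h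
    by (simp add: f[OF that] g[OF that] algebra_simps)
  \<comment> \<open>Work inwards from the far end: at level \<open>K\<close>, \<open>top\<close>
    leaves \<open>g K = x * g (K - 1)\<close>, and each further level is one
    \<open>continuant_step\<close>.\<close>
  have "continuant (Suc m) x t * g (K - m) = x * continuant m x t * g (K - m - 1)" if "m < K" for m
    using that
  proof (induction m)
    case 0
    then show ?case using top g[of K] by simp
  next
    case (Suc m)
    let ?h = "K - Suc m"
    have h: "K - m = ?h + 1"
      using Suc.prems by simp
    have "g ?h = x * (g (?h + 1) - (1 - t) * x * g ?h + g (?h - 1))"
      using g[of ?h] diff[of "?h + 1"] Suc.prems by simp
    then have "(1 + (1 - t) * x\<^sup>2) * g ?h = x * g (?h + 1) + x * g (?h - 1)"
      by (simp add: algebra_simps power2_eq_square)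
    moreover have "continuant (Suc m) x t * g (?h + 1) = x * continuant m x t * g ?h"
      using Suc.IH Suc.prems by (simp add: h)
    ultimately have "continuant (Suc (Suc m)) x t * g ?h = continuant (Suc m) x t * (x * g (?h - 1))"
      by (rule continuant_step)
    then show ?case
      by (simp only: ac_simps)
  qed
  from this[of M] have "continuant K x t * g 1 = x * continuant M x t * g 0"
    by (simp add: Suc)
  moreover have "g 0 = c + x * (g 1 - (1 - t) * x * g 0)"
    using bottom diff[of 1] Suc by simp
  then have "(1 + (1 - t) * x\<^sup>2) * g 0 = x * g 1 + c"
    by (simp add: algebra_simps power2_eq_square)
  ultimately show ?thesis
    unfolding Suc by (intro continuant_step)
qed

text \<open>This rests on L_n = F_(n+1) + s F_(n-1) with s = -x^2, followed by one use of the
  recurrence of \<open>Lambda\<close>.\<close>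

lemma continuant_denominator:
  "continuant (Suc (Suc m)) x t - x\<^sup>2 * continuant m x t =
    Lambda (Suc m) x t - x\<^sup>2 * Lambda m x t"
proof -
  have Lambda_eq: "Lambda (Suc m) x t = Phi (Suc (Suc m)) x t - x\<^sup>2 * Phi m x t" for m
  proof (induction m rule: induct_nat_012)
    case (ge2 m)
    then show ?case
      unfolding Lambda_Suc_Suc[of "Suc m"] ge2 by (simp add: Phi_Suc_Suc algebra_simps)
  qed (simp_all add: Lambda_def Phi_def algebra_simps power2_eq_square)
  have "continuant (Suc (Suc m)) x t - x\<^sup>2 * continuant m x t =
      Lambda (Suc (Suc m)) x t - (1 - t) * x\<^sup>2 * Lambda (Suc m) x t"
    unfolding Lambda_eq continuant_def by (simp add: algebra_simps)
  also have "\<dots> = Lambda (Suc m) x t - x\<^sup>2 * Lambda m x t"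
    unfolding Lambda_Suc_Suc by (simp add: algebra_simps)
  finally show ?thesis .
qed

lemma continuant_numerator:
  "continuant (Suc m) x t + x * continuant m x t =
    (1 + x) * Phi (Suc m) x t - x\<^sup>2 * (1 + (1 - t) * x) * Phi m x t"
  by (simp add: continuant_def Phi_Suc_Suc algebra_simps power2_eq_square)

theorem theorem2:
  fixes k :: nat and x t :: "int poly fps"
  defines "x \<equiv> fps_X"
    and "t \<equiv> fps_const [:0, 1:]"
  assumes "k \<ge> 1"
  shows "Abs_fps (\<lambda>n. path_poly n (2 * k) [:0, 1:]) =
    fps_quot ((1 + x) * Phi k x t - x\<^sup>2 * (1 + (1 - t) * x) * Phi (k - 1) x t)
             (Lambda k x t - x\<^sup>2 * Lambda (k - 1) x t)"
proof -
  obtain m where k: "k = Suc m"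
    using assms(3) by (cases k) auto
  define G where "G = tail_gf (- int k) (int k) ([:0, 1:] :: int poly)"
  have G: "G p h = of_bool (h \<in> {0, -1}) +
      x * (t ^ of_bool (is_turn p Up h) * G Up (h + 1) + t ^ of_bool (is_turn p Down h) * G Down (h - 1))"
    if "- int k \<le> h" "h \<le> int k" for p h
    unfolding G_def x_def t_def using that by (intro tail_gf_rec) simp
  have out: "G p h = 0" if "h < - int k \<or> h > int k" for p h
    unfolding G_def using that by (intro tail_gf_outside) auto
  \<comment> \<open>Vertices at heights 0 and -1 are never extremal, so the previous step is
    irrelevant there and one unknown per height remains.\<close>
  have same: "G Down 0 = G Up 0" "G Up (-1) = G Down (-1)"
    using k by (simp add: G[where h = 0] is_turn_def, simp add: G[where h = "-1"] is_turn_def)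
  \<comment> \<open>The inhomogeneous term collects the empty remainder and the step down across the
    cut.\<close>
  have upper: "continuant (Suc k) x t * G Down (int 0) = continuant k x t * (1 + x * G Down (-1))"
  proof (rule ladder_elimination[where f = "\<lambda>h. G Up (int h)"])
    show "G Down (int 0) = 1 + x * G Down (-1) + x * G Up (int 1)"
      by (simp add: G[where h = 0] is_turn_def algebra_simps)
  next
    fix h :: nat
    assume h: "1 \<le> h" "h \<le> k"
    show "G Up (int h) = x * (G Up (int (h + 1)) + t * G Down (int (h - 1)))"
      using h by (subst G) (simp_all add: is_turn_def of_nat_diff add.commute)
    show "G Down (int h) = x * (G Up (int (h + 1)) + G Down (int (h - 1)))"
      using h by (subst G) (simp_all add: is_turn_def of_nat_diff add.commute)
  qed (simp add: out)
  \<comment> \<open>Level \<open>h\<close> is now height -1 - h, so outward means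
    \<open>Down\<close>; the strip ends at -k = -1 - m, hence \<open>m\<close> further
    levels.\<close>
  have lower: "continuant (Suc m) x t * G Up (- 1 - int 0) = continuant m x t * (1 + x * G Up 0)"
  proof (rule ladder_elimination[where f = "\<lambda>h. G Down (- 1 - int h)"])
    show "G Up (- 1 - int 0) = 1 + x * G Up 0 + x * G Down (- 1 - int 1)"
      using k by (simp add: G[where h = "-1"] is_turn_def algebra_simps)
  next
    fix h :: nat
    assume h: "1 \<le> h" "h \<le> m"
    have shift: "- 1 - int h + 1 = - 1 - int (h - 1)" "- 1 - int h - 1 = - 1 - int (h + 1)"
      using h by simp_all
    show "G Down (- 1 - int h) = x * (G Down (- 1 - int (h + 1)) + t * G Up (- 1 - int (h - 1)))"
      using h k by (subst G) (simp_all only: shift, simp_all add: is_turn_def algebra_simps)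
    show "G Up (- 1 - int h) = x * (G Down (- 1 - int (h + 1)) + G Up (- 1 - int (h - 1)))"
      using h k by (subst G) (simp_all only: shift, simp_all add: is_turn_def algebra_simps)
  qed (simp add: out k)
  \<comment> \<open>Expanding \<open>upper\<close> produces the left side of \<open>lower\<close>
    times \<open>x\<close>, so the unknown at height -1 is replaced without dividing.\<close>
  have "G Up 0 * (continuant (Suc (Suc m)) x t - x\<^sup>2 * continuant m x t) =
      continuant (Suc m) x t + x * continuant m x t"
    using upper lower unfolding k by (simp add: same) algebra
  then have "G Up 0 * (Lambda k x t - x\<^sup>2 * Lambda (k - 1) x t) =
      (1 + x) * Phi k x t - x\<^sup>2 * (1 + (1 - t) * x) * Phi (k - 1) x t"
    by (simp only: continuant_denominator continuant_numerator k diff_Suc_1)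
  moreover have "fps_nth (Lambda k x t - x\<^sup>2 * Lambda (k - 1) x t) 0 = 1"
    unfolding x_def using assms(3) by (rule fps_nth_0_denominator)
  ultimately have "G Up 0 =
      fps_quot ((1 + x) * Phi k x t - x\<^sup>2 * (1 + (1 - t) * x) * Phi (k - 1) x t)
        (Lambda k x t - x\<^sup>2 * Lambda (k - 1) x t)"
    by (simp only: fps_quot_eq_iff)
  then show ?thesis
    by (simp only: path_poly_gf G_def)
qed

end
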